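(* For any vector $y\in\mathbb{R}^{2n-1}$, there is a polynomial-time algorithm for finding a vertex of the polyhedron $[y]$.
   Context: Fix $n\ge 1$ and $\hat X\in\mathbb{R}^{n\times n}$ (part of the input together with $y$). $\operatorname{vec}$ stacks the columns of a matrix, $\hat x=\operatorname{vec}(\hat X)$. Let $e$ be the all-ones vector and let $A\in\mathbb{R}^{(2n-1)\times n^2}$ consist of the first $2n-1$ rows of $\begin{bmatrix} I_n\otimes e^T\\ e^T\otimes I_n\end{bmatrix}$. $v_+$ is the entrywise positive part of $v$. Define $y\sim y'$ iff $(\hat x+A^Ty)_+=(\hat x+A^Ty')_+$, and $[y]=\{y'\in\mathbb{R}^{2n-1}:y'\sim y\}$; this is a polyhedron in $\mathbb{R}^{2n-1}$. *)

theory Defs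
  imports
    Complex_Main
    "HOL-Library.Log_Nat"
    "HOL-Computational_Algebra.Polynomial"
    "Jordan_Normal_Form.Matrix"
begin

section \<open>The polyhedron\<close>

text \<open>Indices start at 0.\<close>

definition vec_stack :: "'a mat \<Rightarrow> 'a vec" where
  "vec_stack X = vec (dim_row X * dim_col X) (\<lambda>k. X $$ (k mod dim_row X, k div dim_row X))"

definition kronecker :: "'a::times mat \<Rightarrow> 'a mat \<Rightarrow> 'a mat" where
  "kronecker A B = mat (dim_row A * dim_row B) (dim_col A * dim_col B)
     (\<lambda>(i, j). A $$ (i div dim_row B, j div dim_col B) * B $$ (i mod dim_row B, j mod dim_col B))"

definition ones_row :: "nat \<Rightarrow> real mat" where
  "ones_row n = mat 1 n (\<lambda>_. 1)"

definition first_rows :: "nat \<Rightarrow> 'a mat \<Rightarrow> 'a mat" where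
  "first_rows m M = mat m (dim_col M) (\<lambda>(i, j). M $$ (i, j))"

definition constraint_mat :: "nat \<Rightarrow> real mat" where
  "constraint_mat n =
     first_rows (2 * n - 1) (kronecker (1\<^sub>m n) (ones_row n) @\<^sub>r kronecker (ones_row n) (1\<^sub>m n))"

definition pos_part :: "real vec \<Rightarrow> real vec" where
  "pos_part v = map_vec (\<lambda>a. max a 0) v"

definition equiv_dual :: "nat \<Rightarrow> real mat \<Rightarrow> real vec \<Rightarrow> real vec \<Rightarrow> bool" where
  "equiv_dual n X y y' \<longleftrightarrow>
     pos_part (vec_stack X + (constraint_mat n)\<^sup>T *\<^sub>v y)
       = pos_part (vec_stack X + (constraint_mat n)\<^sup>T *\<^sub>v y')"

definition dual_class :: "nat \<Rightarrow> real mat \<Rightarrow> real vec \<Rightarrow> real vec set" where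
  "dual_class n X y = {y' \<in> carrier_vec (2 * n - 1). equiv_dual n X y' y}"

text \<open>
  A vertex of a polyhedron is an extreme point. This is \<open>extreme_point_of\<close> of HOL-Analysis,
  restated because the type \<^typ>\<open>real vec\<close> (of vectors of all dimensions) is not a real vector
  space. It is meant for sets of vectors of one common dimension.
\<close>

definition vertex_of :: "real vec \<Rightarrow> real vec set \<Rightarrow> bool" where
  "vertex_of v P \<longleftrightarrow> v \<in> P \<and>
     \<not> (\<exists>a\<in>P. \<exists>b\<in>P. a \<noteq> b \<and> (\<exists>u. 0 < u \<and> u < 1 \<and> v = (1 - u) \<cdot>\<^sub>v a + u \<cdot>\<^sub>v b))"


section \<open>Algorithms on real data\<close>

text \<open>
  While programs for a random access machine with a memory of natural numbers (for indices, with
  indirect addressing) and a memory of reals. Every step costs one unit; expressions are evaluated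
  within a step, which is harmless because their sizes are fixed by the program. Index arithmetic
  has no multiplication, so that the bit length of an index grows by at most a constant per
  step. The reals have field operations and comparisons, but no rounding, and only rational
  constants. Division by zero yields zero.
\<close>

type_synonym state = "(nat \<Rightarrow> nat) \<times> (nat \<Rightarrow> real)"

datatype iexp =
    INum nat
  | ICell iexp
  | IAdd iexp iexp
  | ISub iexp iexp

datatype rexp =
    RNum rat
  | RCell iexp
  | RAdd rexp rexp
  | RSub rexp rexp
  | RMul rexp rexp
  | RDiv rexp rexp

datatype bexp =
    ILess iexp iexp
  | RLess rexp rexp
  | Neg bexp
  | Conj bexp bexp

text \<open>In assignments the first argument evaluates to the address of the cell written to.\<close>

datatype com =
    Skip
  | IAssign iexp iexp
  | RAssign iexp rexp
  | Seq com com
  | Cond bexp com com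
  | While bexp com

fun ival :: "iexp \<Rightarrow> state \<Rightarrow> nat" where
  "ival (INum k) s = k"
| "ival (ICell a) s = fst s (ival a s)"
| "ival (IAdd a b) s = ival a s + ival b s"
| "ival (ISub a b) s = ival a s - ival b s"

fun rval :: "rexp \<Rightarrow> state \<Rightarrow> real" where
  "rval (RNum q) s = of_rat q"
| "rval (RCell a) s = snd s (ival a s)"
| "rval (RAdd a b) s = rval a s + rval b s"
| "rval (RSub a b) s = rval a s - rval b s"
| "rval (RMul a b) s = rval a s * rval b s"
| "rval (RDiv a b) s = rval a s / rval b s"

fun bval :: "bexp \<Rightarrow> state \<Rightarrow> bool" where
  "bval (ILess a b) s \<longleftrightarrow> ival a s < ival b s"
| "bval (RLess a b) s \<longleftrightarrow> rval a s < rval b s"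
| "bval (Neg b) s \<longleftrightarrow> \<not> bval b s"
| "bval (Conj b c) s \<longleftrightarrow> bval b s \<and> bval c s"

text \<open>A configuration whose program is \<^const>\<open>Skip\<close> has halted.\<close>

fun step :: "com \<times> state \<Rightarrow> com \<times> state" where
  "step (Skip, s) = (Skip, s)"
| "step (IAssign a e, s) = (Skip, ((fst s)(ival a s := ival e s), snd s))"
| "step (RAssign a e, s) = (Skip, (fst s, (snd s)(ival a s := rval e s)))"
| "step (Seq c d, s) =
     (if c = Skip then (d, s) else let (c', s') = step (c, s) in (Seq c' d, s'))"
| "step (Cond b c d, s) = (if bval b s then c else d, s)"
| "step (While b c, s) = (if bval b s then Seq c (While b c) else Skip, s)"

text \<open>The input is a natural number \<open>n\<close>, in index cell 0, and a list of reals, in the first real cells.\<close>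

definition initial_state :: "nat \<times> real list \<Rightarrow> state" where
  "initial_state inp = (case inp of (n, xs) \<Rightarrow>
     ((\<lambda>_. 0)(0 := n), \<lambda>k. if k < length xs then xs ! k else 0))"

definition run :: "com \<Rightarrow> nat \<times> real list \<Rightarrow> nat \<Rightarrow> com \<times> state" where
  "run c inp t = (step ^^ t) (c, initial_state inp)"

text \<open>Number of bits of a rational number: numerator, denominator and sign.\<close>

definition bit_size :: "real \<Rightarrow> nat" where
  "bit_size x = (case quotient_of (the_inv of_rat x) of (p, q) \<Rightarrow> nat (bitlen \<bar>p\<bar> + bitlen q) + 1)"

text \<open>
  A program \<open>c\<close> solves a problem with set of instances \<open>D\<close>, encoded by \<open>enc\<close>, in polynomial time
  if, with one program and one polynomial for all instances,
  \<^item> on all real data it halts with a solution after a number of steps polynomial in the number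
    of input data (polynomial time in the real number model), and
  \<^item> on rational data, all numbers in memory have bit lengths that are polynomial in the bit
    length of the input. Then the program is also a polynomial time algorithm in the bit model.
  The natural number in the input is counted in unary.
\<close>

definition solves_in_polynomial_time ::
  "com \<Rightarrow> 'i set \<Rightarrow> ('i \<Rightarrow> nat \<times> real list) \<Rightarrow> ('i \<Rightarrow> (nat \<Rightarrow> real) \<Rightarrow> bool) \<Rightarrow> bool" where
  "solves_in_polynomial_time c D enc sol \<longleftrightarrow>
     (\<exists>p :: nat poly. \<forall>i\<in>D. case enc i of (n, xs) \<Rightarrow>
        \<exists>t \<le> poly p (n + length xs). \<exists>I R. run c (enc i) t = (Skip, (I, R)) \<and> sol i R) \<and>
     (\<exists>p :: nat poly. \<forall>i\<in>D. case enc i of (n, xs) \<Rightarrow>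
        set xs \<subseteq> \<rat> \<longrightarrow>
        (\<forall>t k. bit_size (snd (snd (run c (enc i) t)) k)
           \<le> poly p (n + sum_list (map bit_size xs))))"

end

theory Submission
  imports Defs
begin

text \<open>
  Read \<open>y\<close> as a potential \<open>p\<close> on the \<open>2n\<close> nodes of the complete bipartite graph
  \<open>K\<^sub>n\<^sub>,\<^sub>n\<close>: the nodes \<open>j < n\<close> are the columns of \<open>X\<close>, the nodes \<open>n + i\<close> its rows. The
  constraint row that was dropped from \<open>A\<close> belongs to the node \<open>2n - 1\<close>, the root, whose potential
  is therefore fixed to 0. Entry \<open>e\<close> of \<open>vec X + A\<^sup>T y\<close> is the slack \<open>x\<^sub>e + p\<^sub>j + p\<^sub>n\<^sub>+\<^sub>i\<close> of the
  edge \<open>e\<close> between column \<open>j = e div n\<close> and row \<open>i = e mod n\<close>. The class of \<open>y\<close> fixes the slack of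
  an edge if it is positive, and only keeps it nonpositive otherwise. So an edge of
  nonnegative slack at a point of the class is tight: its slack is constant on every segment in the
  class that has the point in its interior. If every node is linked to the root by tight edges, then
  no such segment exists, and the point is a vertex (\<open>rigid_imp_vertex\<close>).

  Such a point is found as in Prim's algorithm. Keep a set \<open>C\<close> of marked nodes that are linked to the
  root. Among the edges between \<open>C\<close> and its complement, take one of largest slack \<open>m\<close>. If \<open>m \<ge> 0\<close>,
  it is tight and its unmarked end can be marked. If \<open>m < 0\<close>, all crossing edges have negative slack.
  Raise the potentials of the unmarked nodes on the side of the unmarked end by \<open>-m\<close>, and lower those
  on the other side by the same amount. Slacks within \<open>C\<close> and within its complement do not change,
  the chosen edge becomes tight, and no crossing edge gets positive slack, since each of them gains
  at most \<open>-m\<close> and has slack at most \<open>m\<close> (\<open>feasible_shifted\<close>, \<open>rigid_insert\<close>). After \<open>2n - 1\<close> rounds,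
  each of quadratic cost, all nodes are marked (\<open>wp_prog\<close>).

  For the bit lengths, only additions and subtractions are performed. Thus all numbers stay in the
  additive group of the multiples of \<open>1/D\<close>, where \<open>D\<close> is a common denominator of the data. A slack
  involves three numbers, so a round multiplies the largest absolute value by at most 4 (\<open>growth\<close>).
  After fewer than \<open>2n\<close> rounds this costs \<open>O(n)\<close> additional bits (\<open>bit_size_le\<close>). The real number
  model is the case in which the group is all of \<open>\<real>\<close>.
\<close>

section \<open>Timed total correctness with a memory invariant\<close>

text \<open>
  Within \<open>T\<close> steps the configuration halts in a state satisfying \<open>Q\<close>, and all numbers that are in the
  real memory on the way lie in \<open>S\<close>. Recursion on the number of steps, rather than quantification
  over them, lets the proof rules below be proved by unfolding one step at a time.
\<close>

fun halts :: "real set \<Rightarrow> nat \<Rightarrow> (state \<Rightarrow> bool) \<Rightarrow> com \<times> state \<Rightarrow> bool" where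
  "halts S 0 Q (c, s) \<longleftrightarrow> range (snd s) \<subseteq> S \<and> c = Skip \<and> Q s"
| "halts S (Suc T) Q (c, s) \<longleftrightarrow>
     range (snd s) \<subseteq> S \<and> (c = Skip \<and> Q s \<or> halts S T Q (step (c, s)))"

lemma halts_range: "halts S T Q (c, s) \<Longrightarrow> range (snd s) \<subseteq> S"
  by (cases T) auto

lemma halts_Skip [simp]: "halts S T Q (Skip, s) \<longleftrightarrow> range (snd s) \<subseteq> S \<and> Q s"
  by (induction T) auto

lemma halts_mono:
  "halts S T Q cs \<Longrightarrow> T \<le> T' \<Longrightarrow> (\<And>s. range (snd s) \<subseteq> S \<Longrightarrow> Q s \<Longrightarrow> Q' s) \<Longrightarrow> halts S T' Q' cs"
proof (induction S T Q cs arbitrary: T' rule: halts.induct)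
  case (1 S Q c s)
  then show ?case by (cases T') auto
next
  case (2 S T Q c s)
  then obtain T'' where "T' = Suc T''" by (cases T') auto
  with 2 show ?case by auto
qed

lemma steps_Skip: "(step ^^ t) (Skip, s) = (Skip, s)"
  by (induction t) auto

lemma halts_imp_steps:
  "halts S T Q (c, s) \<Longrightarrow> \<exists>t\<le>T. \<exists>s'. (step ^^ t) (c, s) = (Skip, s') \<and> Q s'"
proof (induction T arbitrary: c s)
  case 0
  then show ?case by (cases s) auto
next
  case (Suc T)
  show ?case
  proof (cases "c = Skip \<and> Q s")
    case True
    then have "(step ^^ 0) (c, s) = (Skip, s)" by simp
    with True show ?thesis by blast
  next
    case False
    obtain c' s' where st: "step (c, s) = (c', s')" by (cases "step (c, s)")
    with False Suc.prems have "halts S T Q (c', s')" by auto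
    from Suc.IH[OF this] obtain t s'' where "t \<le> T" "(step ^^ t) (c', s') = (Skip, s'')" "Q s''"
      by auto
    then show ?thesis using st
      by (intro exI[of _ "Suc t"]) (auto simp: funpow_Suc_right simp del: funpow.simps)
  qed
qed

lemma halts_imp_range:
  "halts S T Q (c, s) \<Longrightarrow> range (snd (snd ((step ^^ t) (c, s)))) \<subseteq> S"
proof (induction T arbitrary: c s t)
  case 0
  then show ?case by (auto simp: steps_Skip)
next
  case (Suc T)
  show ?case
  proof (cases "c = Skip")
    case True
    then show ?thesis using Suc.prems by (auto simp: steps_Skip)
  next
    case False
    obtain c' s' where st: "step (c, s) = (c', s')" by (cases "step (c, s)")
    with False Suc.prems have h: "halts S T Q (c', s')" by auto
    show ?thesis
    proof (cases t)
      case 0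
      then show ?thesis using Suc.prems by auto
    next
      case (Suc u)
      then show ?thesis using Suc.IH[OF h, of u] st
        by (simp add: funpow_Suc_right del: funpow.simps)
    qed
  qed
qed

lemma halts_Seq:
  "halts S T (\<lambda>s. halts S U Q (d, s)) (c, s) \<Longrightarrow> halts S (Suc (T + U)) Q (Seq c d, s)"
proof (induction T arbitrary: c s)
  case 0
  then show ?case by auto
next
  case (Suc T)
  show ?case
  proof (cases "c = Skip")
    case True
    with Suc.prems have "halts S U Q (d, s)" by simp
    then have "halts S (Suc (T + U)) Q (d, s)" by (rule halts_mono) auto
    moreover have "step (Seq c d, s) = (d, s)" using True by simp
    ultimately show ?thesis
      using halts_range[OF Suc.prems] halts.simps(2)[of S "Suc (T + U)" Q "Seq c d" s]
      by (metis add_Suc)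
  next
    case False
    obtain c' s' where st: "step (c, s) = (c', s')" by (cases "step (c, s)")
    with False Suc.prems have "halts S T (\<lambda>s. halts S U Q (d, s)) (c', s')" by auto
    from Suc.IH[OF this] show ?thesis using False st Suc.prems by auto
  qed
qed

text \<open>
  The assumption on the initial memory keeps invariants free of \<open>S\<close>: membership in \<open>S\<close> only has to be
  shown for the values that are assigned.
\<close>

definition wp :: "real set \<Rightarrow> nat \<Rightarrow> com \<Rightarrow> (state \<Rightarrow> bool) \<Rightarrow> state \<Rightarrow> bool" where
  "wp S T c Q s \<longleftrightarrow> (range (snd s) \<subseteq> S \<longrightarrow> halts S T Q (c, s))"

lemma wp_mono:
  "wp S T c Q s \<Longrightarrow> T \<le> T' \<Longrightarrow> (\<And>s. Q s \<Longrightarrow> Q' s) \<Longrightarrow> wp S T' c Q' s"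
  unfolding wp_def by (blast intro: halts_mono)

lemma wp_time: "wp S T c Q s \<Longrightarrow> T \<le> T' \<Longrightarrow> wp S T' c Q s"
  by (rule wp_mono)

lemma wp_Skip: "Q s \<Longrightarrow> wp S 0 Skip Q s"
  by (simp add: wp_def)

lemma wp_IAssign:
  "Q (I(ival a (I, R) := ival e (I, R)), R) \<Longrightarrow> wp S 1 (IAssign a e) Q (I, R)"
  by (simp add: wp_def)

lemma wp_RAssign:
  "rval e (I, R) \<in> S \<Longrightarrow> Q (I, R(ival a (I, R) := rval e (I, R))) \<Longrightarrow> wp S 1 (RAssign a e) Q (I, R)"
  by (auto simp: wp_def)

lemma wp_Seq:
  "wp S T c (wp S U d Q) s \<Longrightarrow> wp S (Suc (T + U)) (Seq c d) Q s"
  unfolding wp_def by (blast intro: halts_Seq halts_mono)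

lemma wp_Seq_via:
  "wp S T c M s \<Longrightarrow> (\<And>s. M s \<Longrightarrow> wp S U d Q s) \<Longrightarrow> wp S (Suc (T + U)) (Seq c d) Q s"
  by (rule wp_Seq) (blast intro: wp_mono)

lemma wp_Cond:
  assumes "bval b s \<Longrightarrow> wp S T c Q s" "\<not> bval b s \<Longrightarrow> wp S U d Q s"
  shows "wp S (Suc (T + U)) (Cond b c d) Q s"
  using assms unfolding wp_def by (auto intro: halts_mono)

text \<open>
  All loops are counted: \<open>Inv i\<close> holds after \<open>i\<close> iterations, of which there are exactly \<open>m\<close>. An
  iteration costs two steps besides its body, for the test and for removing the \<open>Skip\<close>
  that is left of the body.
\<close>

lemma wp_While:
  assumes body: "\<And>i s. i < m \<Longrightarrow> Inv i s \<Longrightarrow> bval b s \<and> wp S T c (Inv (Suc i)) s"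
    and exit: "\<And>s. Inv m s \<Longrightarrow> \<not> bval b s \<and> Q s"
    and init: "Inv 0 s"
  shows "wp S (m * (T + 2) + 1) (While b c) Q s"
proof -
  have "wp S (d * (T + 2) + 1) (While b c) Q s" if "Inv i s" "i + d = m" for d i s
    using that
  proof (induction d arbitrary: i s)
    case 0
    then show ?case using exit by (simp add: wp_def)
  next
    case (Suc d)
    have b: "bval b s" and "wp S T c (Inv (Suc i)) s" using body[of i s] Suc.prems by auto
    moreover have "wp S (d * (T + 2) + 1) (While b c) Q s'" if "Inv (Suc i) s'" for s'
      using Suc.IH[of "Suc i" s'] Suc.prems that by simp
    ultimately have "wp S T c (wp S (d * (T + 2) + 1) (While b c) Q) s"
      by (blast intro: wp_mono)
    from wp_Seq[OF this] b have "wp S (Suc (Suc (T + (d * (T + 2) + 1)))) (While b c) Q s"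
      by (simp add: wp_def)
    then show ?case by (rule wp_mono) auto
  qed
  from this[of 0 s m] init show ?thesis by simp
qed


section \<open>Rigid sets of nodes\<close>

definition slack :: "nat \<Rightarrow> (nat \<Rightarrow> real) \<Rightarrow> (nat \<Rightarrow> real) \<Rightarrow> nat \<Rightarrow> real" where
  "slack n x p e = x e + p (e div n) + p (n + e mod n)"

text \<open>
  The potential \<open>p\<close> represents a member of the class of the vector that \<open>q\<close> represents.
\<close>

definition feasible :: "nat \<Rightarrow> (nat \<Rightarrow> real) \<Rightarrow> (nat \<Rightarrow> real) \<Rightarrow> (nat \<Rightarrow> real) \<Rightarrow> bool" where
  "feasible n x q p \<longleftrightarrow> (\<forall>e<n * n. max (slack n x p e) 0 = max (slack n x q e) 0)"

text \<open>
  This states that tight edges link \<open>C\<close> to the root, in dual form: every perturbation \<open>d\<close> that fixes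
  the root and the slacks of all tight edges vanishes on \<open>C\<close>. In this form neither paths nor trees are
  needed, and the condition is visibly monotone in the set of tight edges.
\<close>

definition rigid :: "nat \<Rightarrow> (nat \<Rightarrow> real) \<Rightarrow> (nat \<Rightarrow> real) \<Rightarrow> nat set \<Rightarrow> bool" where
  "rigid n x p C \<longleftrightarrow> (\<forall>d :: nat \<Rightarrow> real. d (2 * n - 1) = 0 \<longrightarrow>
     (\<forall>e<n * n. 0 \<le> slack n x p e \<longrightarrow> d (e div n) + d (n + e mod n) = 0) \<longrightarrow> (\<forall>k\<in>C. d k = 0))"

definition crossing :: "nat \<Rightarrow> nat set \<Rightarrow> nat \<Rightarrow> bool" where
  "crossing n C e \<longleftrightarrow> (e div n \<in> C) \<noteq> (n + e mod n \<in> C)"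

definition free_end :: "nat \<Rightarrow> nat set \<Rightarrow> nat \<Rightarrow> nat" where
  "free_end n C e = (if e div n \<in> C then n + e mod n else e div n)"

text \<open>
  The potential after a round that has chosen an edge of slack \<open>m\<close> with unmarked end \<open>b\<close>. Columns and
  rows get opposite signs, such that slacks between unmarked nodes do not change.
\<close>

definition shifted :: "nat \<Rightarrow> nat set \<Rightarrow> nat \<Rightarrow> real \<Rightarrow> (nat \<Rightarrow> real) \<Rightarrow> nat \<Rightarrow> real" where
  "shifted n C b m p k =
     (if 0 \<le> m \<or> k \<in> C then p k else if (k < n) = (b < n) then p k - m else p k + m)"

text \<open>
  The result of searching the first \<open>k\<close> edges: \<open>b\<close> is the unmarked end of a crossing edge whose slack
  \<open>m\<close> is maximal.
\<close>

definition heaviest_crossing ::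
    "nat \<Rightarrow> nat set \<Rightarrow> (nat \<Rightarrow> real) \<Rightarrow> (nat \<Rightarrow> real) \<Rightarrow> nat \<Rightarrow> nat \<Rightarrow> real \<Rightarrow> bool" where
  "heaviest_crossing n C x p k b m \<longleftrightarrow>
     (\<exists>e<k. crossing n C e \<and> b = free_end n C e \<and> m = slack n x p e) \<and>
     (\<forall>e<k. crossing n C e \<longrightarrow> slack n x p e \<le> m)"

lemma end_less:
  fixes e n :: nat
  assumes "e < n * n"
  shows "e div n < n" "e mod n < n" "0 < n"
proof -
  show "0 < n" using assms by (cases n) auto
  then show "e div n < n" "e mod n < n" using assms by (auto simp: less_mult_imp_div_less)
qed

lemma free_end_less: "e < n * n \<Longrightarrow> free_end n C e < 2 * n"
  using end_less[of e n] by (auto simp: free_end_def)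

lemma free_end_notin: "crossing n C e \<Longrightarrow> free_end n C e \<notin> C"
  by (auto simp: crossing_def free_end_def)

text \<open>
  An unmarked column is joined to the root, which is a row, by an edge. If all columns are marked,
  then column 0 is, and an unmarked row is joined to it.
\<close>

lemma ex_crossing:
  assumes n: "1 \<le> n" and root: "2 * n - 1 \<in> C" and k: "k < 2 * n" "k \<notin> C"
  shows "\<exists>e<n * n. crossing n C e"
proof (cases "\<exists>j<n. j \<notin> C")
  case True
  then obtain j where j: "j < n" "j \<notin> C" by auto
  have "j * n + (n - 1) < Suc j * n" using n by simp
  also have "\<dots> \<le> n * n" using j by (intro mult_le_mono1) simp
  finally have lt: "j * n + (n - 1) < n * n" .
  have "(r + j * n) div n = j" "(r + j * n) mod n = r" if "r < n" for r
    using that by simp_all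
  from this[of "n - 1"] have "(j * n + (n - 1)) div n = j" "(j * n + (n - 1)) mod n = n - 1"
    using n by (simp_all only: add.commute)
  moreover have "n + (n - 1) = 2 * n - 1" using n by simp
  ultimately have "crossing n C (j * n + (n - 1))"
    using j root by (simp add: crossing_def)
  with lt show ?thesis by blast
next
  case False
  then have "n \<le> k" "0 \<in> C" using k n by (auto intro: leI)
  then have "crossing n C (k - n)" "k - n < n * n"
    using k n by (auto simp: crossing_def intro: less_le_trans[of _ n])
  then show ?thesis by blast
qed

text \<open>
  A crossing edge on the side of \<open>b\<close> gains \<open>-m\<close>, which is not more than its slack lacks to 0 because
  \<open>m\<close> is maximal. A crossing edge on the other side loses \<open>-m\<close>.
\<close>

lemma slack_shifted:
  assumes h: "heaviest_crossing n C x p (n * n) b m" and m: "m < 0" and e: "e < n * n"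
  shows "if crossing n C e then slack n x p e < 0 \<and> slack n x (shifted n C b m p) e \<le> 0
         else slack n x (shifted n C b m p) e = slack n x p e"
proof -
  have "slack n x p e \<le> m" if "crossing n C e"
    using h e that by (auto simp: heaviest_crossing_def)
  then show ?thesis
    using m end_less[OF e] by (auto simp: slack_def shifted_def crossing_def)
qed

lemma feasible_shifted:
  assumes h: "heaviest_crossing n C x p (n * n) b m" and f: "feasible n x q p"
  shows "feasible n x q (shifted n C b m p)"
proof (cases "m < 0")
  case True
  show ?thesis
    unfolding feasible_def
  proof (intro allI impI)
    fix e assume e: "e < n * n"
    show "max (slack n x (shifted n C b m p) e) 0 = max (slack n x q e) 0"
      using slack_shifted[OF h True e] f e
      by (auto simp: feasible_def split: if_splits)
  qed
next
  case False
  then have "shifted n C b m p = p" by (auto simp: shifted_def)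
  with f show ?thesis by simp
qed

text \<open>
  The shift keeps tight edges tight: those edges whose slack it changes have negative slack before.
  The new tight edge joins \<open>b\<close> to a node of \<open>C\<close>, so a perturbation that vanishes on \<open>C\<close> vanishes at
  \<open>b\<close>.
\<close>

lemma rigid_insert:
  assumes h: "heaviest_crossing n C x p (n * n) b m" and r: "rigid n x p C"
  shows "rigid n x (shifted n C b m p) (insert b C)"
proof -
  let ?p = "shifted n C b m p"
  obtain e where e: "e < n * n" "crossing n C e" "b = free_end n C e" "m = slack n x p e"
    using h by (auto simp: heaviest_crossing_def)
  have tight: "0 \<le> slack n x ?p e"
    using e end_less[OF e(1)] by (auto simp: slack_def shifted_def crossing_def free_end_def)
  have mono: "0 \<le> slack n x ?p e'" if "e' < n * n" "0 \<le> slack n x p e'" for e'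
  proof (cases "m < 0")
    case True
    then show ?thesis using slack_shifted[OF h True that(1)] that by (auto split: if_splits)
  next
    case False
    then have "?p = p" by (auto simp: shifted_def)
    with that show ?thesis by simp
  qed
  show ?thesis
    unfolding rigid_def
  proof (intro allI impI)
    fix d :: "nat \<Rightarrow> real"
    assume d: "d (2 * n - 1) = 0"
      "\<forall>e<n * n. 0 \<le> slack n x ?p e \<longrightarrow> d (e div n) + d (n + e mod n) = 0"
    then have C: "\<forall>k\<in>C. d k = 0" using r mono unfolding rigid_def by blast
    have "d (e div n) + d (n + e mod n) = 0" using d tight e by blast
    then have "d b = 0" using C e by (auto simp: crossing_def free_end_def)
    with C show "\<forall>k\<in>insert b C. d k = 0" by simp
  qed
qed



section \<open>The program\<close>

text \<open>
  Index cells 0 to 6 hold \<open>n\<close>, the address \<open>n\<^sup>2\<close> of the potentials, three loop variables, the unmarked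
  end \<open>b\<close> of the best edge so far, and the number of rounds; cell \<open>7 + k\<close> is the mark of node \<open>k\<close>.
  The potentials use the input cells of \<open>y\<close>. The cell behind the input, which initially is 0, is the
  potential of the root, and the cell after that holds the slack of the best edge.
\<close>

abbreviation "cell_n \<equiv> ICell (INum 0)"
abbreviation "cell_base \<equiv> ICell (INum 1)"
abbreviation "cell_k \<equiv> ICell (INum 2)"
abbreviation "cell_i \<equiv> ICell (INum 3)"
abbreviation "cell_j \<equiv> ICell (INum 4)"
abbreviation "cell_b \<equiv> ICell (INum 5)"
abbreviation "cell_round \<equiv> ICell (INum 6)"
abbreviation "mark_addr a \<equiv> IAdd (INum 7) a"
abbreviation "root_expr \<equiv> ISub (IAdd cell_n cell_n) (INum 1)"
abbreviation "pot_addr a \<equiv> IAdd cell_base a"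
abbreviation "best_addr \<equiv> pot_addr (IAdd cell_n cell_n)"
abbreviation "marked a \<equiv> ILess (INum 0) (ICell (mark_addr a))"
abbreviation "Iff_b b c \<equiv> Conj (Neg (Conj b (Neg c))) (Neg (Conj c (Neg b)))"
abbreviation "slack_expr \<equiv>
  RAdd (RAdd (RCell cell_k) (RCell (pot_addr cell_j))) (RCell (pot_addr (IAdd cell_n cell_i)))"

text \<open>
  Since index arithmetic has no multiplication, \<open>n\<^sup>2\<close> is computed by repeated addition.
\<close>

definition prog_init :: com where
  "prog_init =
     Seq (While (ILess cell_k cell_n)
            (Seq (IAssign (INum 1) (IAdd cell_base cell_n))
                 (IAssign (INum 2) (IAdd cell_k (INum 1)))))
         (IAssign (mark_addr root_expr) (INum 1))"

text \<open>
  As long as no crossing edge has been found, \<open>b\<close> is the root. The root is always marked and so never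
  the unmarked end of an edge. A single loop variable \<open>k\<close> runs through the edges, while \<open>i\<close> and
  \<open>j\<close> count along as remainder and quotient of \<open>k\<close> by \<open>n\<close>.
\<close>

definition prog_search_body :: com where
  "prog_search_body =
     Seq (Cond (Iff_b (marked cell_j) (marked (IAdd cell_n cell_i)))
            Skip
            (Cond (Conj (ILess cell_b root_expr) (Neg (RLess (RCell best_addr) slack_expr)))
               Skip
               (Seq (RAssign best_addr slack_expr)
                  (Cond (marked cell_j)
                     (IAssign (INum 5) (IAdd cell_n cell_i))
                     (IAssign (INum 5) cell_j)))))
     (Seq (IAssign (INum 2) (IAdd cell_k (INum 1)))
     (Seq (IAssign (INum 3) (IAdd cell_i (INum 1)))
          (Cond (ILess cell_i cell_n)
             Skip
             (Seq (IAssign (INum 3) (INum 0)) (IAssign (INum 4) (IAdd cell_j (INum 1)))))))"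

definition prog_search :: com where
  "prog_search =
     Seq (IAssign (INum 2) (INum 0))
     (Seq (IAssign (INum 3) (INum 0))
     (Seq (IAssign (INum 4) (INum 0))
     (Seq (IAssign (INum 5) root_expr)
          (While (ILess cell_k cell_base) prog_search_body))))"

definition prog_shift_body :: com where
  "prog_shift_body =
     Seq (Cond (marked cell_k)
            Skip
            (Cond (Iff_b (ILess cell_k cell_n) (ILess cell_b cell_n))
               (RAssign (pot_addr cell_k) (RSub (RCell (pot_addr cell_k)) (RCell best_addr)))
               (RAssign (pot_addr cell_k) (RAdd (RCell (pot_addr cell_k)) (RCell best_addr)))))
         (IAssign (INum 2) (IAdd cell_k (INum 1)))"

definition prog_shift :: com where
  "prog_shift =
     Cond (RLess (RCell best_addr) (RNum 0))
       (Seq (IAssign (INum 2) (INum 0)) (While (ILess cell_k (IAdd cell_n cell_n)) prog_shift_body))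
       Skip"

definition prog_round :: com where
  "prog_round =
     Seq prog_search
     (Seq prog_shift
     (Seq (IAssign (mark_addr cell_b) (INum 1))
          (IAssign (INum 6) (IAdd cell_round (INum 1)))))"

text \<open>
  The result overwrites the matrix. It fits without touching the potentials, as \<open>2n - 1 \<le> n\<^sup>2\<close>.
\<close>

definition prog_copy :: com where
  "prog_copy =
     Seq (IAssign (INum 2) (INum 0))
         (While (ILess cell_k root_expr)
            (Seq (RAssign cell_k (RCell (pot_addr cell_k)))
                 (IAssign (INum 2) (IAdd cell_k (INum 1)))))"

definition prog :: com where
  "prog = Seq prog_init (Seq (While (ILess cell_round root_expr) prog_round) prog_copy)"

definition layout ::
    "nat \<Rightarrow> nat set \<Rightarrow> (nat \<Rightarrow> real) \<Rightarrow> (nat \<Rightarrow> real) \<Rightarrow> nat \<Rightarrow> state \<Rightarrow> bool" where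
  "layout n C x p t s \<longleftrightarrow>
     fst s 0 = n \<and> fst s 1 = n * n \<and> fst s 6 = t \<and>
     (\<forall>k<2 * n. fst s (7 + k) = (if k \<in> C then 1 else 0)) \<and>
     (\<forall>e<n * n. snd s e = x e) \<and> (\<forall>k<2 * n. snd s (n * n + k) = p k)"

definition search_state ::
    "nat \<Rightarrow> nat set \<Rightarrow> (nat \<Rightarrow> real) \<Rightarrow> (nat \<Rightarrow> real) \<Rightarrow> nat \<Rightarrow> nat \<Rightarrow> state \<Rightarrow> bool" where
  "search_state n C x p t k s \<longleftrightarrow>
     layout n C x p t s \<and> fst s 2 = k \<and> fst s 3 = k mod n \<and> fst s 4 = k div n \<and>
     (heaviest_crossing n C x p k (fst s 5) (snd s (n * n + 2 * n)) \<or>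
      fst s 5 = 2 * n - 1 \<and> (\<forall>e<k. \<not> crossing n C e))"

lemma heaviest_crossing_Suc:
  assumes "heaviest_crossing n C x p k b m \<or> (\<forall>e<k. \<not> crossing n C e)" "crossing n C k"
    and "slack n x p k \<ge> m \<or> (\<forall>e<k. \<not> crossing n C e)"
  shows "heaviest_crossing n C x p (Suc k) (free_end n C k) (slack n x p k)"
  using assms by (auto simp: heaviest_crossing_def less_Suc_eq)

lemma heaviest_crossing_Suc_skip:
  assumes "heaviest_crossing n C x p k b m" "crossing n C k \<Longrightarrow> slack n x p k \<le> m"
  shows "heaviest_crossing n C x p (Suc k) b m"
  using assms by (auto simp: heaviest_crossing_def less_Suc_eq)

text \<open>
  Hence the value \<open>2n - 1\<close> of \<open>b\<close> unambiguously signals that no crossing edge has been found yet.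
\<close>

lemma heaviest_crossing_less_root:
  assumes "heaviest_crossing n C x p k b m" "k \<le> n * n" "2 * n - 1 \<in> C"
  shows "b < 2 * n - 1"
proof -
  obtain e where "e < k" "crossing n C e" "b = free_end n C e"
    using assms by (auto simp: heaviest_crossing_def)
  with assms(2) have "e < n * n" "crossing n C e" "b = free_end n C e" by auto
  then have "b < 2 * n" "b \<notin> C" using free_end_less free_end_notin by auto
  with assms(3) show ?thesis by (cases "b = 2 * n - 1") auto
qed

text \<open>
  The body first treats edge \<open>k\<close> and then advances the counters. The assertion \<open>next_state\<close>
  between these parts is the invariant for \<open>k + 1\<close>, except that the counters still belong to \<open>k\<close>.
  Here and below the numbers of steps are generous.
\<close>

lemma wp_search_body:
  assumes inv: "search_state n C x p t k s" and k: "k < n * n" and root: "2 * n - 1 \<in> C"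
    and S: "\<And>e. e < n * n \<Longrightarrow> slack n x p e \<in> S"
  shows "wp S 30 prog_search_body (search_state n C x p t (Suc k)) s"
proof -
  obtain I R where s: "s = (I, R)" by (cases s)
  note ends = end_less[OF k]
  have I: "I 0 = n" "I (Suc 0) = n * n" "I 6 = t" "I 2 = k" "I 3 = k mod n" "I 4 = k div n"
    "\<And>l. l < 2 * n \<Longrightarrow> I (7 + l) = (if l \<in> C then 1 else 0)"
    "\<And>e. e < n * n \<Longrightarrow> R e = x e" "\<And>l. l < 2 * n \<Longrightarrow> R (n * n + l) = p l"
    using inv by (auto simp: search_state_def layout_def s)
  have marks: "I (7 + k div n) = (if k div n \<in> C then 1 else 0)"
    "I (7 + (n + k mod n)) = (if n + k mod n \<in> C then 1 else 0)"
    using I(7)[of "k div n"] I(7)[of "n + k mod n"] ends by auto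
  have test: "0 < I (7 + k div n) \<longleftrightarrow> k div n \<in> C" "0 < I (7 + (n + k mod n)) \<longleftrightarrow> n + k mod n \<in> C"
    using marks by simp_all
  have slack: "R k + R (n * n + k div n) + R (n * n + (n + k mod n)) = slack n x p k"
    using I(8)[of k] I(9)[of "k div n"] I(9)[of "n + k mod n"] ends k by (simp add: slack_def)
  \<comment> \<open>memory after treating edge \<open>k\<close>, before advancing the counters\<close>
  define next_state where "next_state I' R' \<longleftrightarrow>
     layout n C x p t (I', R') \<and> I' 2 = k \<and> I' 3 = k mod n \<and> I' 4 = k div n \<and>
     (heaviest_crossing n C x p (Suc k) (I' 5) (R' (n * n + 2 * n)) \<or>
      I' 5 = 2 * n - 1 \<and> (\<forall>e<Suc k. \<not> crossing n C e))" for I' R'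
  have advance: "wp S 10 (Seq (IAssign (INum 2) (IAdd cell_k (INum 1)))
     (Seq (IAssign (INum 3) (IAdd cell_i (INum 1)))
          (Cond (ILess cell_i cell_n)
             Skip
             (Seq (IAssign (INum 3) (INum 0)) (IAssign (INum 4) (IAdd cell_j (INum 1)))))))
     (search_state n C x p t (Suc k)) s'" if h: "next_state (fst s') (snd s')" for s'
  proof -
    obtain I' R' where s': "s' = (I', R')" by (cases s')
    have wrap: "Suc (k mod n) < n \<or> Suc (k mod n) = n"
      using ends(2) by (metis Suc_lessI)
    have n0: "I' 0 = n" using h by (simp add: next_state_def layout_def s')
    show ?thesis
      unfolding s'
      apply (rule wp_time)
       apply (rule wp_Seq wp_IAssign)+
       apply (rule wp_Cond)
        apply (rule wp_Skip)
      subgoal using h ends n0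
        by (simp add: search_state_def next_state_def layout_def s' mod_Suc div_Suc)
       apply (rule wp_Seq wp_IAssign)+
      subgoal using h ends n0 wrap
        by (simp add: search_state_def next_state_def layout_def s' mod_Suc div_Suc)
      by simp
  qed
  have best: "heaviest_crossing n C x p (Suc k) (free_end n C k) (slack n x p k)"
    if "crossing n C k" "\<not> (I 5 < 2 * n - 1 \<and> slack n x p k \<le> R (n * n + 2 * n))"
  proof -
    have "heaviest_crossing n C x p k (I 5) (R (n * n + 2 * n)) \<or> (\<forall>e<k. \<not> crossing n C e)"
      using inv by (auto simp: search_state_def s)
    then show ?thesis
      using that heaviest_crossing_less_root[OF _ _ root, of x p k "I 5"] k
      by (auto intro!: heaviest_crossing_Suc)
  qed
  show ?thesis
    unfolding s prog_search_body_def
    apply (rule wp_time)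
     apply (rule wp_Seq_via[where M = "\<lambda>s'. next_state (fst s') (snd s')"])
      apply (rule wp_Cond)
       apply (rule wp_Skip)
    subgoal
      using inv marks I heaviest_crossing_Suc_skip[of n C x p k]
      by (auto simp: search_state_def next_state_def s crossing_def less_Suc_eq split: if_splits)
      apply (rule wp_Cond)
       apply (rule wp_Skip)
    subgoal
      using inv I slack heaviest_crossing_Suc_skip[of n C x p k]
      by (auto simp: search_state_def next_state_def s less_Suc_eq mult_2 split: if_splits)
      apply (rule wp_Seq wp_RAssign)+
    subgoal using slack S[OF k] I by simp
      apply (rule wp_Cond)
       apply (rule wp_IAssign)
    subgoal
      using inv I slack test best
      by (auto simp: search_state_def next_state_def s layout_def mult_2 free_end_def crossing_def)
      apply (rule wp_IAssign)
    subgoal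
      using inv I slack test best
      by (auto simp: search_state_def next_state_def s layout_def mult_2 free_end_def crossing_def)
    apply (erule advance)
    apply simp
    done
qed

lemma wp_search:
  assumes lay: "layout n C x p t s" and root: "2 * n - 1 \<in> C"
    and S: "\<And>e. e < n * n \<Longrightarrow> slack n x p e \<in> S"
  shows "wp S (32 * (n * n) + 20) prog_search (search_state n C x p t (n * n)) s"
proof -
  obtain I R where s: "s = (I, R)" by (cases s)
  show ?thesis
    unfolding s prog_search_def
    apply (rule wp_time)
     apply (rule wp_Seq wp_IAssign)+
     apply (rule wp_While[where m = "n * n" and Inv = "search_state n C x p t"])
       apply (rule conjI)
    subgoal by (auto simp: search_state_def layout_def)
       apply (erule wp_search_body)
    subgoal .
    subgoal by (rule root)
    subgoal by (rule S)
    subgoal by (auto simp: search_state_def layout_def)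
    subgoal using lay by (auto simp: search_state_def layout_def s mult_2)
    apply simp
    done
qed

text \<open>
  The potentials of the first \<open>k\<close> nodes have been updated.
\<close>

definition shift_state where
  "shift_state n C x p t b m k s \<longleftrightarrow>
     layout n C x (\<lambda>l. if l < k then shifted n C b m p l else p l) t s \<and>
     fst s 2 = k \<and> fst s 5 = b \<and> snd s (n * n + 2 * n) = m"

lemma wp_shift_body:
  assumes inv: "shift_state n C x p t b m k s" and k: "k < 2 * n" and m: "m < 0"
    and S: "\<And>l. l < 2 * n \<Longrightarrow> shifted n C b m p l \<in> S"
  shows "wp S 15 prog_shift_body (shift_state n C x p t b m (Suc k)) s"
proof -
  obtain I R where s: "s = (I, R)" by (cases s)
  have I: "I 0 = n" "I (Suc 0) = n * n" "I 2 = k" "I 5 = b" "R (n * n + 2 * n) = m"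
    "I (7 + k) = (if k \<in> C then 1 else 0)" "R (n * n + k) = p k"
    using inv k by (auto simp: shift_state_def layout_def s)
  show ?thesis
    unfolding s prog_shift_body_def
    apply (rule wp_time)
     apply (rule wp_Seq)
     apply (rule wp_Cond)
      apply (rule wp_Skip)
      apply (rule wp_IAssign)
    subgoal using inv I by (auto simp: shift_state_def layout_def s shifted_def less_Suc_eq)
     apply (rule wp_Cond)
      apply (rule wp_RAssign)
    subgoal using I S[OF k] m by (auto simp: shifted_def mult_2 split: if_splits)
      apply (rule wp_IAssign)
    subgoal using inv I m k by (auto simp: shift_state_def layout_def s shifted_def less_Suc_eq mult_2)
      apply (rule wp_RAssign)
    subgoal using I S[OF k] m by (auto simp: shifted_def mult_2 split: if_splits)
      apply (rule wp_IAssign)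
    subgoal using inv I m k by (auto simp: shift_state_def layout_def s shifted_def less_Suc_eq mult_2)
    apply simp
    done
qed

lemma wp_shift:
  assumes lay: "layout n C x p t s" and b: "fst s 5 = b" and m: "snd s (n * n + 2 * n) = m"
    and S: "\<And>l. l < 2 * n \<Longrightarrow> shifted n C b m p l \<in> S"
  shows "wp S (34 * n + 20) prog_shift
    (\<lambda>s. layout n C x (shifted n C b m p) t s \<and> fst s 5 = b) s"
proof -
  obtain I R where s: "s = (I, R)" by (cases s)
  have I: "I 0 = n" "I (Suc 0) = n * n" "I 5 = b" "R (n * n + 2 * n) = m"
    using lay b m by (auto simp: layout_def s)
  show ?thesis
    unfolding s prog_shift_def
    apply (rule wp_time)
     apply (rule wp_Cond)
      apply (rule wp_Seq wp_IAssign)+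
      apply (rule wp_While[where m = "2 * n" and Inv = "shift_state n C x p t b m"])
        apply (rule conjI)
    subgoal by (auto simp: shift_state_def layout_def)
        apply (erule wp_shift_body)
    subgoal .
    subgoal using I by (simp add: mult_2)
    subgoal by (rule S)
    subgoal by (auto simp: shift_state_def layout_def)
    subgoal using lay I by (auto simp: shift_state_def layout_def s)
     apply (rule wp_Skip)
    subgoal using lay I by (auto simp: layout_def s shifted_def mult_2)
    apply simp
    done
qed

lemma wp_init:
  assumes n: "1 \<le> n"
  shows "wp S (6 * n + 10) prog_init (layout n {2 * n - 1} R (\<lambda>k. R (n * n + k)) 0)
    ((\<lambda>_. 0)(0 := n), R)"
proof -
  define Inv :: "nat \<Rightarrow> state \<Rightarrow> bool" where
    "Inv i s \<longleftrightarrow> s = ((\<lambda>_. 0)(0 := n, 1 := i * n, 2 := i), R)" for i s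
  show ?thesis
    unfolding prog_init_def
    apply (rule wp_time)
     apply (rule wp_Seq[where U = 1])
     apply (rule wp_While[where m = n and Inv = Inv and T = 3])
       apply (rule conjI)
    subgoal by (simp add: Inv_def)
    subgoal for i s
      apply (simp add: Inv_def)
      apply (rule wp_time)
      apply (rule wp_Seq wp_IAssign)+
      apply (simp_all add: Inv_def fun_upd_twist add.commute)
      done
      apply (rule conjI)
    subgoal by (simp add: Inv_def)
    subgoal for s
      apply (simp only: Inv_def)
      apply (rule wp_IAssign)
      using n apply (auto simp: layout_def)
      done
    subgoal by (auto simp: Inv_def)
    apply simp
    done
qed

lemma wp_copy:
  assumes lay: "layout n C x p t s" and S: "\<And>k. k < 2 * n \<Longrightarrow> p k \<in> S"
  shows "wp S (12 * n + 10) prog_copy (\<lambda>s. \<forall>k<2 * n - 1. snd s k = p k) s"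
proof -
  define Inv :: "nat \<Rightarrow> state \<Rightarrow> bool" where
    "Inv i s \<longleftrightarrow> fst s 0 = n \<and> fst s 1 = n * n \<and> fst s 2 = i \<and> (\<forall>k<i. snd s k = p k) \<and>
       (\<forall>k<2 * n. snd s (n * n + k) = p k)" for i s
  have fits: "2 * n - 1 \<le> n * n"
  proof (cases n)
    case (Suc l)
    then show ?thesis by (cases l) auto
  qed simp
  obtain I R where s: "s = (I, R)" by (cases s)
  show ?thesis
    unfolding s prog_copy_def
    apply (rule wp_time)
     apply (rule wp_Seq wp_IAssign)+
     apply (rule wp_While[where m = "2 * n - 1" and Inv = Inv and T = 3])
       apply (rule conjI)
    subgoal by (simp add: Inv_def mult_2)
    subgoal for i s
      apply (cases s)
      apply simp
      apply (rule wp_time)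
      apply (rule wp_Seq wp_RAssign)+
      subgoal using S by (auto simp: Inv_def)
      apply (rule wp_IAssign)
      subgoal using fits by (auto simp: Inv_def less_Suc_eq)
      apply simp
      done
    subgoal by (simp add: Inv_def mult_2)
    subgoal using lay by (simp add: Inv_def layout_def s)
    apply simp
    done
qed

text \<open>
  Every round marks one more node, which determines the number of rounds. The group \<open>G\<close> and the bound
  on absolute values carry the information for bounding bit lengths.
\<close>

definition round_state where
  "round_state n x G B t s \<longleftrightarrow> (\<exists>C p. layout n C x p t s \<and>
     C \<subseteq> {..<2 * n} \<and> 2 * n - 1 \<in> C \<and> card C = Suc t \<and>
     (\<forall>k. p k \<in> G \<and> \<bar>p k\<bar> \<le> B * 4 ^ t) \<and> p (2 * n - 1) = x (n * n + (2 * n - 1)) \<and>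
     feasible n x (\<lambda>k. x (n * n + k)) p \<and> rigid n x p C)"

definition safe :: "nat \<Rightarrow> real set \<Rightarrow> real \<Rightarrow> real set" where
  "safe n G B = {r \<in> G. \<bar>r\<bar> \<le> B * 4 ^ (2 * n)}"

context
  fixes n :: nat and x :: "nat \<Rightarrow> real" and G :: "real set" and B :: real
  assumes n: "1 \<le> n"
    and G: "\<And>a b. a \<in> G \<Longrightarrow> b \<in> G \<Longrightarrow> a + b \<in> G \<and> a - b \<in> G"
    and x: "\<And>k. x k \<in> G \<and> \<bar>x k\<bar> \<le> B"
begin

lemma B_nonneg: "0 \<le> B"
  using x[of 0] abs_ge_zero order_trans by blast

text \<open>
  With \<open>c = B * 4 ^ t\<close>, a slack is the sum of two potentials and a datum, all at most \<open>c\<close>; a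
  potential changes by at most one slack, hence to at most \<open>c + 3 * c\<close>.
\<close>

lemma growth:
  assumes p: "\<And>k. p k \<in> G \<and> \<bar>p k\<bar> \<le> B * 4 ^ t"
  shows "slack n x p e \<in> G \<and> \<bar>slack n x p e\<bar> \<le> 3 * (B * 4 ^ t)"
    and "m \<in> G \<Longrightarrow> \<bar>m\<bar> \<le> 3 * (B * 4 ^ t) \<Longrightarrow>
      shifted n C b m p k \<in> G \<and> \<bar>shifted n C b m p k\<bar> \<le> B * 4 ^ Suc t"
proof -
  have "B \<le> B * 4 ^ t" using B_nonneg mult_left_mono[of 1 "4 ^ t" B] by simp
  then have "\<bar>x e\<bar> \<le> B * 4 ^ t" using x[of e] by linarith
  then show "slack n x p e \<in> G \<and> \<bar>slack n x p e\<bar> \<le> 3 * (B * 4 ^ t)"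
    using p[of "e div n"] p[of "n + e mod n"] x[of e] G by (auto simp: slack_def)
  show "shifted n C b m p k \<in> G \<and> \<bar>shifted n C b m p k\<bar> \<le> B * 4 ^ Suc t"
    if "m \<in> G" "\<bar>m\<bar> \<le> 3 * (B * 4 ^ t)"
    using p[of k] that G by (auto simp: shifted_def)
qed

lemma safeI:
  assumes "r \<in> G" "\<bar>r\<bar> \<le> B * 4 ^ t" "t \<le> 2 * n"
  shows "r \<in> safe n G B"
proof -
  have "B * 4 ^ t \<le> B * 4 ^ (2 * n)"
    using B_nonneg assms(3) by (intro mult_left_mono power_increasing) auto
  with assms show ?thesis by (simp add: safe_def)
qed

lemma wp_round:
  assumes r: "round_state n x G B t s" and t: "t < 2 * n - 1"
  shows "wp (safe n G B) (32 * (n * n) + 34 * n + 50) prog_round (round_state n x G B (Suc t)) s"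
proof -
  obtain C p where lay: "layout n C x p t s" and C: "C \<subseteq> {..<2 * n}" "2 * n - 1 \<in> C" "card C = Suc t"
    and p: "\<And>k. p k \<in> G \<and> \<bar>p k\<bar> \<le> B * 4 ^ t" and root: "p (2 * n - 1) = x (n * n + (2 * n - 1))"
    and f: "feasible n x (\<lambda>k. x (n * n + k)) p" and rg: "rigid n x p C"
    using r unfolding round_state_def by blast
  \<comment> \<open>a crossing edge exists, so the search cannot end with \<open>b\<close> still at the root\<close>
  have "C \<noteq> {..<2 * n}" using C t by auto
  then obtain k where "k < 2 * n" "k \<notin> C" using C by blast
  then obtain e where e: "e < n * n" "crossing n C e" using ex_crossing n C by blast
  have slack_safe: "slack n x p e \<in> safe n G B" for e
    using growth(1)[where p = p, OF p, where e = e] B_nonneg t by (intro safeI[of _ "Suc t"]) auto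
  have 1: "wp (safe n G B) (32 * (n * n) + 20) prog_search (search_state n C x p t (n * n)) s"
    using lay C slack_safe by (intro wp_search) auto
  have 2: "wp (safe n G B) (34 * n + 25)
      (Seq prog_shift (Seq (IAssign (mark_addr cell_b) (INum 1))
          (IAssign (INum 6) (IAdd cell_round (INum 1))))) (round_state n x G B (Suc t)) s'"
    if s': "search_state n C x p t (n * n) s'" for s'
  proof -
    define b where "b = fst s' 5"
    define m where "m = snd s' (n * n + 2 * n)"
    have h: "heaviest_crossing n C x p (n * n) b m" and lay: "layout n C x p t s'"
      using s' e by (auto simp: search_state_def b_def m_def)
    obtain e where e: "e < n * n" "crossing n C e" "b = free_end n C e" "m = slack n x p e"
      using h by (auto simp: heaviest_crossing_def)
    have b: "b < 2 * n" "b \<notin> C" using e free_end_less free_end_notin by auto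
    let ?p = "shifted n C b m p"
    have p': "?p k \<in> G \<and> \<bar>?p k\<bar> \<le> B * 4 ^ Suc t" for k
      using growth(1)[where p = p, OF p, where e = e] growth(2)[where p = p, OF p, where m = m] e(4) by blast
    have card: "card (insert b C) = Suc (Suc t)"
      using b C finite_subset[OF C(1)] by simp
    have root': "?p (2 * n - 1) = x (n * n + (2 * n - 1))"
      using C(2) root by (simp add: shifted_def)
    have final: "round_state n x G B (Suc t) (I(7 + b := 1, 6 := Suc t), R)"
      if "layout n C x ?p t (I, R)" for I R
      unfolding round_state_def
    proof (intro exI conjI)
      show "layout n (insert b C) x ?p (Suc t) (I(7 + b := 1, 6 := Suc t), R)"
        using that b by (auto simp: layout_def)
      show "insert b C \<subseteq> {..<2 * n}" using C b by auto
      show "2 * n - 1 \<in> insert b C" using C by simp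
    qed (use card p' root' feasible_shifted[OF h f] rigid_insert[OF h rg] in auto)
    show ?thesis
      apply (rule wp_time)
       apply (rule wp_Seq_via[where U = 4])
        apply (rule wp_shift[OF lay b_def[symmetric] m_def[symmetric]])
      subgoal for l using p'[of l] t by (intro safeI[of _ "Suc t"]) auto
      subgoal for s''
        apply (cases s'')
        apply simp
        apply (rule wp_time)
         apply (rule wp_Seq wp_IAssign)+
        using final[of "fst s''" "snd s''"] apply (auto simp: layout_def)
        done
      apply simp
      done
  qed
  show ?thesis
    unfolding prog_round_def
    by (rule wp_time, rule wp_Seq_via[OF 1 2]) simp_all
qed

lemma wp_prog:
  "wp (safe n G B) (300 * (1 + n) ^ 3) prog
     (\<lambda>s. \<exists>p. (\<forall>k<2 * n - 1. snd s k = p k) \<and> p (2 * n - 1) = x (n * n + (2 * n - 1)) \<and>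
        feasible n x (\<lambda>k. x (n * n + k)) p \<and> rigid n x p {..<2 * n})
     ((\<lambda>_. 0)(0 := n), x)"
proof -
  have init: "round_state n x G B 0 s"
    if "layout n {2 * n - 1} x (\<lambda>k. x (n * n + k)) 0 s" for s
    unfolding round_state_def
    using that n x by (intro exI[of _ "{2 * n - 1}"] exI[of _ "\<lambda>k. x (n * n + k)"])
      (auto simp: feasible_def rigid_def)
  let ?Q = "\<lambda>s. \<exists>p. (\<forall>k<2 * n - 1. snd s k = p k) \<and> p (2 * n - 1) = x (n * n + (2 * n - 1)) \<and>
        feasible n x (\<lambda>k. x (n * n + k)) p \<and> rigid n x p {..<2 * n}"
  have final: "wp (safe n G B) (12 * n + 10) prog_copy ?Q s"
    if r: "round_state n x G B (2 * n - 1) s" for s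
  proof -
    obtain C p where lay: "layout n C x p (2 * n - 1) s"
      and C: "C \<subseteq> {..<2 * n}" "card C = Suc (2 * n - 1)"
      and p: "\<And>k. p k \<in> G \<and> \<bar>p k\<bar> \<le> B * 4 ^ (2 * n - 1)"
      and root: "p (2 * n - 1) = x (n * n + (2 * n - 1))"
      and f: "feasible n x (\<lambda>k. x (n * n + k)) p" and rg: "rigid n x p C"
      using r unfolding round_state_def by blast
    have "C = {..<2 * n}" using C n by (intro card_subset_eq) auto
    then show ?thesis using root f rg p
      by (intro wp_mono[OF wp_copy[OF lay]]) (auto intro!: safeI[of _ "2 * n - 1"])
  qed
  have loop: "wp (safe n G B) (2 * n * (32 * (n * n) + 34 * n + 52) + 1)
      (While (ILess cell_round root_expr) prog_round) (round_state n x G B (2 * n - 1)) s"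
    if "round_state n x G B 0 s" for s
  proof -
    have "wp (safe n G B) ((2 * n - 1) * (32 * (n * n) + 34 * n + 50 + 2) + 1)
      (While (ILess cell_round root_expr) prog_round) (round_state n x G B (2 * n - 1)) s"
    proof (rule wp_While[where Inv = "round_state n x G B"])
      show "bval (ILess cell_round root_expr) s \<and>
          wp (safe n G B) (32 * (n * n) + 34 * n + 50) prog_round (round_state n x G B (Suc i)) s"
        if "i < 2 * n - 1" "round_state n x G B i s" for i s
        using wp_round[OF that(2,1)] that by (auto simp: round_state_def layout_def)
      show "\<not> bval (ILess cell_round root_expr) s \<and> round_state n x G B (2 * n - 1) s"
        if "round_state n x G B (2 * n - 1) s" for s
        using that by (auto simp: round_state_def layout_def)
    qed fact
    then show ?thesis by (rule wp_time) (auto intro!: mult_le_mono)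
  qed
  show ?thesis
    unfolding prog_def
    apply (rule wp_time)
     apply (rule wp_Seq_via[OF wp_init[OF n]])
     apply (rule wp_Seq_via)
      apply (rule loop)
      apply (erule init)
     apply (erule final)
    apply (simp add: power3_eq_cube algebra_simps)
    done
qed

end


section \<open>Vertices of the class\<close>

definition potential :: "nat \<Rightarrow> real vec \<Rightarrow> nat \<Rightarrow> real" where
  "potential n y k = (if k < 2 * n - 1 then y $ k else 0)"

lemma constraint_mat_dim [simp]:
  "dim_row (constraint_mat n) = 2 * n - 1" "dim_col (constraint_mat n) = n * n"
  by (simp_all add: constraint_mat_def first_rows_def kronecker_def ones_row_def append_rows_def)

lemma constraint_mat_entry:
  assumes r: "r < 2 * n - 1" and e: "e < n * n"
  shows "constraint_mat n $$ (r, e) =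
    (if r = e div n then 1 else 0) + (if r = n + e mod n then 1 else 0)"
  using assms end_less[OF e]
  by (auto simp: constraint_mat_def first_rows_def kronecker_def ones_row_def append_rows_def)

text \<open>
  Column \<open>e\<close> of the constraint matrix has a 1 for each end of the edge \<open>e\<close> other than the root.
\<close>

lemma dual_slack:
  assumes X: "X \<in> carrier_mat n n" and y: "y \<in> carrier_vec (2 * n - 1)" and e: "e < n * n"
    and x: "x e = X $$ (e mod n, e div n)"
  shows "(vec_stack X + (constraint_mat n)\<^sup>T *\<^sub>v y) $ e = slack n x (potential n y) e"
proof -
  have "((constraint_mat n)\<^sup>T *\<^sub>v y) $ e = (\<Sum>r<2 * n - 1. constraint_mat n $$ (r, e) * y $ r)"
    using y e by (simp add: scalar_prod_def lessThan_atLeast0)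
  also have "\<dots> = (\<Sum>r<2 * n - 1. (if r = e div n then y $ r else 0) + (if r = n + e mod n then y $ r else 0))"
    using e by (intro sum.cong) (auto simp: constraint_mat_entry)
  also have "\<dots> = potential n y (e div n) + potential n y (n + e mod n)"
    using end_less[OF e] by (simp add: sum.distrib potential_def)
  finally show ?thesis
    using X e x by (simp add: vec_stack_def slack_def)
qed

lemma equiv_dual_iff:
  assumes X: "X \<in> carrier_mat n n" and y: "y \<in> carrier_vec (2 * n - 1)" "y' \<in> carrier_vec (2 * n - 1)"
    and x: "\<And>e. e < n * n \<Longrightarrow> x e = X $$ (e mod n, e div n)"
  shows "equiv_dual n X y' y \<longleftrightarrow> feasible n x (potential n y) (potential n y')"
  using X by (auto simp: equiv_dual_def feasible_def pos_part_def vec_eq_iff vec_stack_def[of X]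
      dual_slack[OF X y(1) _ x, symmetric] dual_slack[OF X y(2) _ x, symmetric])

text \<open>
  Why an edge of nonnegative slack \<open>s\<close> is tight: a positive slack is the same in the whole
  class, and 0 is an extreme value among the nonpositive slacks.
\<close>

lemma convex_pos_part:
  fixes s a b u :: real
  assumes s: "0 \<le> s" "s = (1 - u) * a + u * b" and u: "0 < u" "u < 1"
    and a: "max a 0 = max s 0" and b: "max b 0 = max s 0"
  shows "a = b"
proof (cases "s = 0")
  case True
  with a b have le: "a \<le> 0" "b \<le> 0" by (auto simp: max_def split: if_splits)
  then have "(1 - u) * a \<le> 0" "u * b \<le> 0" using u by (auto simp: mult_nonneg_nonpos)
  with s True have "(1 - u) * a = 0" "u * b = 0" by linarith+
  with u show ?thesis by auto
next
  case False
  with s a b show ?thesis by (auto simp: max_def split: if_splits)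
qed

text \<open>
  If \<open>v\<close> lies strictly between \<open>a\<close> and \<open>b\<close>, then all three have the same slacks on the tight edges of
  \<open>v\<close>. So the difference of \<open>a\<close> and \<open>b\<close> is a perturbation as in the definition of rigidity.
\<close>

lemma rigid_imp_vertex:
  assumes X: "X \<in> carrier_mat n n" and y: "y \<in> carrier_vec (2 * n - 1)" and n: "1 \<le> n"
    and x: "\<And>e. e < n * n \<Longrightarrow> x e = X $$ (e mod n, e div n)"
    and v: "v \<in> carrier_vec (2 * n - 1)"
    and f: "feasible n x (potential n y) (potential n v)"
    and r: "rigid n x (potential n v) {..<2 * n}"
  shows "vertex_of v (dual_class n X y)"
  unfolding vertex_of_def
proof (intro conjI notI)
  show "v \<in> dual_class n X y"
    using equiv_dual_iff[OF X y v x] f v by (simp add: dual_class_def)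
next
  assume "\<exists>a\<in>dual_class n X y. \<exists>b\<in>dual_class n X y.
    a \<noteq> b \<and> (\<exists>u. 0 < u \<and> u < 1 \<and> v = (1 - u) \<cdot>\<^sub>v a + u \<cdot>\<^sub>v b)"
  then obtain a b u where a: "a \<in> dual_class n X y" and b: "b \<in> dual_class n X y" and "a \<noteq> b"
    and u: "0 < u" "u < 1" and comb: "v = (1 - u) \<cdot>\<^sub>v a + u \<cdot>\<^sub>v b"
    by blast
  have dims: "a \<in> carrier_vec (2 * n - 1)" "b \<in> carrier_vec (2 * n - 1)"
    using a b by (auto simp: dual_class_def)
  have fa: "feasible n x (potential n y) (potential n a)"
    and fb: "feasible n x (potential n y) (potential n b)"
    using a b equiv_dual_iff[OF X y dims(1) x] equiv_dual_iff[OF X y dims(2) x]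
    by (auto simp: dual_class_def)
  have pot: "potential n v k = (1 - u) * potential n a k + u * potential n b k" for k
    using dims by (auto simp: potential_def comb)
  define d where "d k = potential n a k - potential n b k" for k
  have "d (e div n) + d (n + e mod n) = 0" if e: "e < n * n" "0 \<le> slack n x (potential n v) e" for e
  proof -
    have "slack n x (potential n v) e =
        (1 - u) * slack n x (potential n a) e + u * slack n x (potential n b) e"
      by (simp add: slack_def pot algebra_simps)
    moreover have "max (slack n x (potential n a) e) 0 = max (slack n x (potential n v) e) 0"
      "max (slack n x (potential n b) e) 0 = max (slack n x (potential n v) e) 0"
      by (simp_all only: f[unfolded feasible_def, rule_format, OF e(1)]
          fa[unfolded feasible_def, rule_format, OF e(1)] fb[unfolded feasible_def, rule_format, OF e(1)])
    ultimately have "slack n x (potential n a) e = slack n x (potential n b) e"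
      using convex_pos_part[OF e(2) _ u] by blast
    then show ?thesis by (simp add: slack_def d_def)
  qed
  moreover have "d (2 * n - 1) = 0" by (simp add: d_def potential_def)
  ultimately have d: "\<forall>k\<in>{..<2 * n}. d k = 0" using r unfolding rigid_def by blast
  have "a $ k = b $ k" if "k < 2 * n - 1" for k
  proof -
    have "d k = 0" using d that by simp
    with that show ?thesis by (simp add: d_def potential_def)
  qed
  with dims have "a = b" by (intro eq_vecI) auto
  with \<open>a \<noteq> b\<close> show False by simp
qed


section \<open>Bit lengths\<close>

lemma rational_quotient:
  assumes "x \<in> \<rat>"
  obtains p q :: int where "0 < q" "coprime p q" "x = of_int p / of_int q"
    "bit_size x = nat (bitlen \<bar>p\<bar> + bitlen q) + 1"
proof -
  obtain r where r: "x = of_rat r" using assms by (auto simp: Rats_def)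
  obtain p q where pq: "quotient_of r = (p, q)" by fastforce
  have "the_inv of_rat x = r"
    unfolding r by (rule the_inv_f_f) (auto intro: injI)
  then have "bit_size x = nat (bitlen \<bar>p\<bar> + bitlen q) + 1"
    using pq by (simp add: bit_size_def)
  moreover have "x = of_int p / of_int q"
    using quotient_of_div[OF pq] r by (simp add: of_rat_divide)
  ultimately show thesis
    using that quotient_of_denom_pos[OF pq] quotient_of_coprime[OF pq] by blast
qed

lemma bit_size_bounds:
  assumes "x \<in> \<rat>"
  obtains q :: int where "0 < q" "q \<le> 2 ^ bit_size x" "x * of_int q \<in> \<int>" "\<bar>x\<bar> \<le> 2 ^ bit_size x"
proof -
  obtain p q :: int where pq: "0 < q" "x = of_int p / of_int q"
    and bs: "bit_size x = nat (bitlen \<bar>p\<bar> + bitlen q) + 1"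
    using rational_quotient[OF assms] by metis
  have "bitlen \<bar>p\<bar> \<le> int (bit_size x)" "bitlen q \<le> int (bit_size x)"
    using bitlen_nonneg[of q] bitlen_nonneg[of "\<bar>p\<bar>"] by (simp_all add: bs)
  then have le: "\<bar>p\<bar> \<le> 2 ^ bit_size x" "q \<le> 2 ^ bit_size x"
    by (simp_all add: bitlen_le_iff_power)
  have "\<bar>x\<bar> \<le> \<bar>of_int p\<bar>" using pq mult_left_mono[of 1 "real_of_int q" "\<bar>of_int p\<bar>"] by (simp add: divide_le_eq)
  also have "\<dots> = real_of_int \<bar>p\<bar>" by simp
  also have "\<dots> \<le> real_of_int (2 ^ bit_size x)" using le(1) of_int_le_iff by blast
  finally have "\<bar>x\<bar> \<le> 2 ^ bit_size x" by simp
  moreover have "x * of_int q \<in> \<int>" using pq by simp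
  ultimately show thesis using that pq le by blast
qed

text \<open>
  The product of the denominators works, because bit lengths add up under multiplication.
\<close>

lemma common_denominator:
  assumes "set xs \<subseteq> \<rat>"
  shows "\<exists>D :: int. 0 < D \<and> D \<le> 2 ^ sum_list (map bit_size xs) \<and>
    (\<forall>x\<in>set xs. x * of_int D \<in> \<int> \<and> \<bar>x\<bar> \<le> 2 ^ sum_list (map bit_size xs))"
  using assms
proof (induction xs)
  case Nil
  then show ?case by (intro exI[of _ 1]) simp
next
  case (Cons x xs)
  let ?L = "sum_list (map bit_size xs)"
  obtain D :: int where D: "0 < D" "D \<le> 2 ^ ?L"
    "\<And>z. z \<in> set xs \<Longrightarrow> z * of_int D \<in> \<int> \<and> \<bar>z\<bar> \<le> 2 ^ ?L"
    using Cons by auto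
  obtain q :: int where q: "0 < q" "q \<le> 2 ^ bit_size x" "x * of_int q \<in> \<int>" "\<bar>x\<bar> \<le> 2 ^ bit_size x"
    using bit_size_bounds[of x] Cons.prems by auto
  have "q * D \<le> 2 ^ (bit_size x + ?L)"
    unfolding power_add using D q by (intro mult_mono) auto
  moreover have "z * of_int (q * D) \<in> \<int> \<and> \<bar>z\<bar> \<le> 2 ^ (bit_size x + ?L)" if "z \<in> set (x # xs)" for z
  proof -
    have "z * of_int q \<in> \<int> \<or> z * of_int D \<in> \<int>" using that D q by auto
    then have "z * of_int q * of_int D \<in> \<int> \<or> z * of_int D * of_int q \<in> \<int>"
      by (auto intro: Ints_mult)
    moreover have "(2 :: real) ^ bit_size x \<le> 2 ^ (bit_size x + ?L)" "(2 :: real) ^ ?L \<le> 2 ^ (bit_size x + ?L)"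
      by (intro power_increasing; simp)+
    moreover have "\<bar>z\<bar> \<le> 2 ^ bit_size x \<or> \<bar>z\<bar> \<le> 2 ^ ?L" using that D q by auto
    ultimately have "\<bar>z\<bar> \<le> 2 ^ (bit_size x + ?L)" "z * of_int q * of_int D \<in> \<int>"
      by (linarith, auto simp: ac_simps)
    then show ?thesis by (simp add: ac_simps)
  qed
  ultimately show ?case using D q by (intro exI[of _ "q * D"]) simp
qed

text \<open>
  In lowest terms, the denominator of \<open>x\<close> divides \<open>D\<close>, and the numerator is \<open>x\<close> times the denominator.
\<close>

lemma bit_size_le:
  fixes D :: int
  assumes D: "0 < D" "D \<le> 2 ^ s" and xD: "x * of_int D \<in> \<int>" and x: "\<bar>x\<bar> \<le> 2 ^ r"
  shows "bit_size x \<le> r + 2 * s + 3"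
proof -
  obtain z where z: "x * of_int D = of_int z" using xD by (auto elim: Ints_cases)
  then have "x = of_int z / of_int D" using D by (simp add: field_simps)
  then have "x \<in> \<rat>" by simp
  then obtain p q :: int where q: "0 < q" and cop: "coprime p q" and pq: "x = of_int p / of_int q"
    and bs: "bit_size x = nat (bitlen \<bar>p\<bar> + bitlen q) + 1"
    using rational_quotient by metis
  have "real_of_int (p * D) = real_of_int (z * q)"
    using z q unfolding pq by (simp add: field_simps)
  then have "p * D = z * q" by (simp only: of_int_eq_iff)
  then have "q dvd p * D" by simp
  then have "q dvd D" using cop by (simp add: coprime_commute coprime_dvd_mult_right_iff)
  then have "q \<le> D" using D by (simp add: zdvd_imp_le)
  with D have qs: "q \<le> 2 ^ s" by linarith
  have "real_of_int \<bar>p\<bar> = \<bar>x\<bar> * of_int q" using q unfolding pq by simp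
  also have "\<dots> \<le> 2 ^ r * of_int (2 ^ s)"
    using x qs q by (intro mult_mono) (auto simp del: of_int_power)
  finally have "real_of_int \<bar>p\<bar> \<le> of_int (2 ^ (r + s))" by (simp add: power_add)
  then have ps: "\<bar>p\<bar> \<le> 2 ^ (r + s)" by (simp only: of_int_le_iff)
  have "(2 :: int) ^ s < 2 ^ (s + 1)" "(2 :: int) ^ (r + s) < 2 ^ (r + s + 1)" by simp_all
  with qs ps have "q < 2 ^ nat (int (s + 1))" "\<bar>p\<bar> < 2 ^ nat (int (r + s + 1))"
    unfolding nat_int by linarith+
  then have "bitlen q \<le> int (s + 1)" "bitlen \<bar>p\<bar> \<le> int (r + s + 1)"
    unfolding bitlen_le_iff_power by simp_all
  then show ?thesis by (simp add: bs)
qed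


section \<open>The algorithm\<close>

text \<open>
  The group \<open>G\<close> is arbitrary in order to cover both requirements on the program by one run: real data,
  and rational data with a common denominator.
\<close>

lemma prog_halts:
  assumes n: "1 \<le> n" and X: "X \<in> carrier_mat n n" and y: "y \<in> carrier_vec (2 * n - 1)"
    and xs: "xs = list_of_vec (vec_stack X) @ list_of_vec y"
    and G: "\<And>a b. a \<in> G \<Longrightarrow> b \<in> G \<Longrightarrow> a + b \<in> G \<and> a - b \<in> G" "0 \<in> G"
    and data: "\<And>a. a \<in> set xs \<Longrightarrow> a \<in> G \<and> \<bar>a\<bar> \<le> B" and B: "0 \<le> B"
  shows "halts (safe n G B) (300 * (1 + n) ^ 3)
    (\<lambda>s. vertex_of (vec (2 * n - 1) (snd s)) (dual_class n X y)) (prog, initial_state (n, xs))"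
proof -
  define x where "x k = (if k < length xs then xs ! k else 0)" for k
  have len: "length xs = n * n + (2 * n - 1)" using X y by (simp add: xs vec_stack_def)
  have xe: "x e = X $$ (e mod n, e div n)" if "e < n * n" for e
    using that X len by (simp add: x_def xs nth_append vec_stack_def)
  have xy: "x (n * n + k) = potential n y k" for k
    using X y len by (auto simp: x_def xs nth_append vec_stack_def potential_def)
  have x: "x k \<in> G \<and> \<bar>x k\<bar> \<le> B" for k
    using data G(2) B by (simp add: x_def)
  have "x k \<in> safe n G B" for k
    using safeI[OF n G(1) x, of "x k" 0] x by simp
  moreover have init: "initial_state (n, xs) = ((\<lambda>_. 0)(0 := n), x)"
    by (auto simp: initial_state_def x_def)
  ultimately have range: "range (snd (initial_state (n, xs))) \<subseteq> safe n G B"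
    by auto
  have vertex: "vertex_of (vec (2 * n - 1) (snd s)) (dual_class n X y)"
    if result: "\<exists>p. (\<forall>k<2 * n - 1. snd s k = p k) \<and> p (2 * n - 1) = x (n * n + (2 * n - 1)) \<and>
        feasible n x (\<lambda>k. x (n * n + k)) p \<and> rigid n x p {..<2 * n}" for s
  proof -
    let ?v = "vec (2 * n - 1) (snd s)"
    obtain p where p: "\<And>k. k < 2 * n - 1 \<Longrightarrow> snd s k = p k" "p (2 * n - 1) = x (n * n + (2 * n - 1))"
      and f: "feasible n x (potential n y) p" and r: "rigid n x p {..<2 * n}"
      using result unfolding xy by blast
    have "potential n ?v k = p k" if "k < 2 * n" for k
    proof (cases "k = 2 * n - 1")
      case True
      then show ?thesis using p(2) by (simp add: xy potential_def)
    next
      case False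
      then show ?thesis using that p(1) by (simp add: potential_def)
    qed
    then have "slack n x (potential n ?v) e = slack n x p e" if "e < n * n" for e
      using end_less[OF that] by (simp add: slack_def)
    then have "feasible n x (potential n y) (potential n ?v)" "rigid n x (potential n ?v) {..<2 * n}"
      using f r by (simp_all add: feasible_def rigid_def)
    then show ?thesis by (intro rigid_imp_vertex[OF X y n xe]) auto
  qed
  have "wp (safe n G B) (300 * (1 + n) ^ 3) prog
      (\<lambda>s. vertex_of (vec (2 * n - 1) (snd s)) (dual_class n X y)) (initial_state (n, xs))"
    unfolding init by (rule wp_mono[OF wp_prog[OF n G(1) x] order_refl vertex])
  with range show ?thesis by (simp add: wp_def)
qed

theorem theorem3p15:
  "\<exists>c. solves_in_polynomial_time c
     {(n :: nat, X :: real mat, y :: real vec).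
        1 \<le> n \<and> X \<in> carrier_mat n n \<and> y \<in> carrier_vec (2 * n - 1)}
     (\<lambda>(n, X, y). (n, list_of_vec (vec_stack X) @ list_of_vec y))
     (\<lambda>(n, X, y) R. vertex_of (vec (2 * n - 1) R) (dual_class n X y))"
proof -
  let ?xs = "\<lambda>X y. list_of_vec (vec_stack X) @ list_of_vec y :: real list"
  let ?p = "[:300:] * [:1, 1:] ^ 3 :: nat poly"
  let ?q = "[:3, 4:] :: nat poly"
  have abs_nonneg: "0 \<le> sum_list (map abs zs)" for zs :: "real list"
    by (induction zs) auto
  have time: "\<exists>t \<le> poly ?p (n + length (?xs X y)). \<exists>I R.
      run prog (n, ?xs X y) t = (Skip, (I, R)) \<and> vertex_of (vec (2 * n - 1) R) (dual_class n X y)"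
    if i: "1 \<le> n" "X \<in> carrier_mat n n" "y \<in> carrier_vec (2 * n - 1)" for n X y
  proof -
    have le: "\<bar>a\<bar> \<le> sum_list (map abs (?xs X y))" if "a \<in> set (?xs X y)" for a
      using that by (intro member_le_sum_list) auto
    have "halts (safe n UNIV (sum_list (map abs (?xs X y)))) (300 * (1 + n) ^ 3)
      (\<lambda>s. vertex_of (vec (2 * n - 1) (snd s)) (dual_class n X y)) (prog, initial_state (n, ?xs X y))"
    proof (rule prog_halts[OF i refl])
      show "a \<in> UNIV \<and> \<bar>a\<bar> \<le> sum_list (map abs (?xs X y))" if "a \<in> set (?xs X y)" for a
        using le[OF that] by simp
      show "0 \<le> sum_list (map abs (?xs X y))" by (rule abs_nonneg)
    qed simp_all
    from halts_imp_steps[OF this] obtain t s where t: "t \<le> 300 * (1 + n) ^ 3"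
      and s: "run prog (n, ?xs X y) t = (Skip, s)"
        "vertex_of (vec (2 * n - 1) (snd s)) (dual_class n X y)"
      unfolding run_def by blast
    have "300 * (1 + n) ^ 3 \<le> poly ?p (n + length (?xs X y))"
      by (simp add: power_mono)
    with t have "t \<le> poly ?p (n + length (?xs X y))" by (rule order_trans)
    with s show ?thesis by (cases s) (auto simp del: poly_mult poly_power)
  qed
  have bits: "bit_size (snd (snd (run prog (n, ?xs X y) t)) k)
      \<le> poly ?q (n + sum_list (map bit_size (?xs X y)))"
    if i: "1 \<le> n" "X \<in> carrier_mat n n" "y \<in> carrier_vec (2 * n - 1)"
      and rat: "set (?xs X y) \<subseteq> \<rat>" for n X y t k
  proof -
    define L where "L = sum_list (map bit_size (?xs X y))"
    obtain D :: int where D: "0 < D" "D \<le> 2 ^ L"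
      and xD: "\<And>a. a \<in> set (?xs X y) \<Longrightarrow> a * of_int D \<in> \<int> \<and> \<bar>a\<bar> \<le> 2 ^ L"
      using common_denominator[OF rat] unfolding L_def by blast
    let ?G = "{r :: real. r * of_int D \<in> \<int>}"
    have "halts (safe n ?G (2 ^ L)) (300 * (1 + n) ^ 3)
      (\<lambda>s. vertex_of (vec (2 * n - 1) (snd s)) (dual_class n X y)) (prog, initial_state (n, ?xs X y))"
      using xD by (intro prog_halts[OF i refl]) (simp_all add: algebra_simps)
    from halts_imp_range[OF this]
    have "snd (snd (run prog (n, ?xs X y) t)) k \<in> safe n ?G (2 ^ L)" (is "?r \<in> _")
      by (auto simp: run_def)
    then have "?r * of_int D \<in> \<int>" "\<bar>?r\<bar> \<le> 2 ^ L * 4 ^ (2 * n)" by (auto simp: safe_def)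
    moreover have "(2 :: real) ^ L * 4 ^ (2 * n) = 2 ^ (L + 4 * n)"
      by (simp add: power_add power_mult)
    ultimately have "bit_size ?r \<le> (L + 4 * n) + 2 * L + 3"
      using bit_size_le[OF D] by metis
    then show ?thesis by (simp add: L_def algebra_simps)
  qed
  show ?thesis
    unfolding solves_in_polynomial_time_def
    by (intro exI[of _ prog] conjI exI[of _ ?p] exI[of _ ?q]) (use time bits in auto)
qed

end
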